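(* Let $g:\mathbb{R}\to\mathbb{R}$ be a function satisfying the following three conditions. (i) $g\in C^1(\mathbb{R},\mathbb{R})$ and there is a constant $K>0$ such that $|g'(x)|\le K$ for all $x\in\mathbb{R}$. (ii) There exist constants $A_0>0$ and $M_0>0$ such that $x^{-1}g(x)\ge A_0$ for all $|x|\ge M_0$. (iii) There exist a constant $\alpha>0$, an integer $m>0$, and two sequences $(a_k)$ and $(b_k)$ with $a_k\to\infty$ and $b_k\to\infty$ as $k\to\infty$, such that $$\tau(a_k)<\frac{2\pi}{m}-\alpha,\qquad \tau(b_k)>\frac{2\pi}{m}+\alpha,$$ where $\tau(c)$ is the least positive period of the orbit of $x'=y,\ y'=-g(x)$ at energy level $c$. Let $0\le t_1<2\pi$ and let the impulse times $t_j$ be the points $t_1+2\pi n$, $n\in\mathbb{Z}$. Then the impulsive differential equation $$\begin{cases} z''+g(z)=0, & t\neq t_j,\\ \Delta z|_{t=t_j}=0,\\ \Delta z'|_{t=t_j}=-2z'(t_j-), & \text{for every impulse time } t_j,\end{cases}$$ has infinitely many $2\pi$-periodic solutions.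
   Context: Notation. $\Delta z|_{t=t_j}=z(t_j+)-z(t_j-)$ and $\Delta z'|_{t=t_j}=z'(t_j+)-z'(t_j-)$, where $\pm$ denote one-sided limits. Thus at each impulse time $z$ is continuous and $z'(t_j+)=-z'(t_j-)$. A solution satisfies the differential equation on each interval between consecutive impulse times and the jump conditions at every impulse time. The impulse times are $2\pi$-periodic, with exactly one in $[0,2\pi)$. Definition of $\tau(c)$. Put $G(x)=\int_0^x g(u)\,du$. Under condition (ii) there is a constant $c_0>0$ such that for every $c\ge c_0$ the level set $\Gamma_c=\{(x,y)\in\mathbb{R}^2:\tfrac12y^2+G(x)=c\}$ is a closed curve that is star-shaped about the origin. It meets the $x$-axis at exactly two points $(h(c),0)$ and $(-h_1(c),0)$, where $h(c)>0$ and $h_1(c)>0$ are determined by $G(h(c))=G(-h_1(c))=c$. For $c\ge c_0$, the solutions of the (non-impulsive) system $x'=y,\ y'=-g(x)$ with orbit $\Gamma_c$ are periodic, and $\tau(c)$ denotes their least positive period: $$\tau(c)=\sqrt2\int_{-h_1(c)}^{h(c)}\frac{du}{\sqrt{c-G(u)}}.$$ The numbers $a_k,b_k$ in condition (iii) are understood to be parameters $\ge c_0$, so that $\tau(a_k),\tau(b_k)$ are defined. *)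

theory Defs
  imports "HOL-Analysis.Analysis"
begin

section \<open>The autonomous system $x' = y$, $y' = -g(x)$\<close>

text \<open>The interval integral is oriented, so this is also the intended primitive for \<open>x < 0\<close>.\<close>

definition potential :: "(real \<Rightarrow> real) \<Rightarrow> real \<Rightarrow> real"
  where "potential g x = (LBINT u=ereal 0..ereal x. g u)"

definition level_set :: "(real \<Rightarrow> real) \<Rightarrow> real \<Rightarrow> (real \<times> real) set"
  where "level_set g c = {(x, y). y\<^sup>2 / 2 + potential g x = c}"

definition closed_curve :: "(real \<times> real) set \<Rightarrow> bool"
  where "closed_curve C \<longleftrightarrow>
    (\<exists>p. simple_path p \<and> pathfinish p = pathstart p \<and> path_image p = C)"

text \<open>A curve (as opposed to the region it bounds) is star-shaped about the origin when every
  ray issuing from the origin meets it exactly once.\<close>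

definition star_shaped_curve :: "(real \<times> real) set \<Rightarrow> bool"
  where "star_shaped_curve C \<longleftrightarrow> (\<forall>v. v \<noteq> 0 \<longrightarrow> (\<exists>!s. s > 0 \<and> s *\<^sub>R v \<in> C))"

text \<open>\<open>energy_threshold g c0\<close> says that \<open>c0\<close> can serve as the constant above which the level sets
  are periodic orbits. The last conjunct (no equilibrium lies on the level set) does not follow
  from the preceding ones; without it the level set could be a star-shaped closed curve but not
  a single orbit. If \<open>g\<close> is continuous and \<open>g x / x\<close> is bounded below by a positive constant for
  large \<open>\<bar>x\<bar>\<close>, every sufficiently large \<open>c0\<close> is a threshold.\<close>

definition energy_threshold :: "(real \<Rightarrow> real) \<Rightarrow> real \<Rightarrow> bool"
  where "energy_threshold g c0 \<longleftrightarrow> c0 > 0 \<and>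
    (\<forall>c\<ge>c0.
      closed_curve (level_set g c) \<and>
      star_shaped_curve (level_set g c) \<and>
      (\<exists>h h1. h > 0 \<and> h1 > 0 \<and> level_set g c \<inter> {(x, y). y = 0} = {(h, 0), (- h1, 0)}) \<and>
      (\<forall>(x, y)\<in>level_set g c. (y, - g x) \<noteq> (0, 0)))"

definition planar_solution :: "(real \<Rightarrow> real) \<Rightarrow> (real \<Rightarrow> real) \<Rightarrow> (real \<Rightarrow> real) \<Rightarrow> bool"
  where "planar_solution g x y \<longleftrightarrow>
    (\<forall>t. (x has_real_derivative y t) (at t) \<and> (y has_real_derivative - g (x t)) (at t))"

definition periodic :: "real \<Rightarrow> (real \<Rightarrow> 'a) \<Rightarrow> bool"
  where "periodic T f \<longleftrightarrow> (\<forall>t. f (t + T) = f t)"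

definition least_positive_period :: "(real \<Rightarrow> 'a) \<Rightarrow> real \<Rightarrow> bool"
  where "least_positive_period f T \<longleftrightarrow>
    T > 0 \<and> periodic T f \<and> (\<forall>S. S > 0 \<and> periodic S f \<longrightarrow> T \<le> S)"

text \<open>The description is proper for levels above an energy threshold when \<open>g\<close> is \<open>C\<^sup>1\<close>: the
  level set is then the orbit of a solution, unique up to time translation, and the value is
  $\sqrt 2 \int_{-h_1(c)}^{h(c)} (c - G(u))^{-1/2}\,du$.\<close>

definition orbit_period :: "(real \<Rightarrow> real) \<Rightarrow> real \<Rightarrow> real"
  where "orbit_period g c =
    (THE T. \<exists>x y. planar_solution g x y \<and> range (\<lambda>t. (x t, y t)) = level_set g c \<and>
                  least_positive_period (\<lambda>t. (x t, y t)) T)"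


section \<open>The impulsive equation\<close>

definition impulse_times :: "real \<Rightarrow> real set"
  where "impulse_times t1 = (\<lambda>n::int. t1 + 2 * pi * of_int n) ` UNIV"

definition one_sided_limits :: "(real \<Rightarrow> real) \<Rightarrow> real \<Rightarrow> real \<Rightarrow> real \<Rightarrow> bool"
  where "one_sided_limits f t l r \<longleftrightarrow> (f \<longlongrightarrow> l) (at_left t) \<and> (f \<longlongrightarrow> r) (at_right t)"

text \<open>Continuity at the impulse times is required in addition to \<open>\<Delta>z = 0\<close>: the latter alone says
  nothing about the value of \<open>z\<close> at the impulse time itself. The value of \<open>deriv z\<close> at an impulse
  time is irrelevant to the one-sided limits.\<close>

definition impulsive_solution :: "(real \<Rightarrow> real) \<Rightarrow> real \<Rightarrow> (real \<Rightarrow> real) \<Rightarrow> bool"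
  where "impulsive_solution g t1 z \<longleftrightarrow>
    (\<forall>t. t \<notin> impulse_times t1 \<longrightarrow>
      z differentiable (at t) \<and> deriv z differentiable (at t) \<and> deriv (deriv z) t + g (z t) = 0) \<and>
    (\<forall>t\<in>impulse_times t1.
      isCont z t \<and>
      (\<exists>l r. one_sided_limits z t l r \<and> r - l = 0) \<and>
      (\<exists>l r. one_sided_limits (deriv z) t l r \<and> r - l = - 2 * l))"

end

theory Submission imports Defs begin

text \<open>The periodic solutions come from the time-reversibility of the equation.
  Let \<open>u\<close> be the solution of $u'' + g(u) = 0$ with \<open>u(0) = x\<close> and \<open>u'(0) = 0\<close>; it is even and \<open>u'\<close>
  is odd. Centre the piece of \<open>u\<close> over \<open>[- \<pi>, \<pi>]\<close> between two consecutive impulse times and repeat it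
  with period \<open>2 \<pi>\<close>. At each impulse time the end \<open>\<pi>\<close> of one copy meets the end \<open>- \<pi>\<close> of the next
  copy: the values agree because \<open>u(- \<pi>) = u(\<pi>)\<close>, and the velocity jumps from \<open>u'(\<pi>)\<close> to
  \<open>u'(- \<pi>) = - u'(\<pi>)\<close>, which is exactly the prescribed reset. In terms of the flow \<open>\<Phi>\<close> and the
  reflection \<open>R(x, y) = (x, - y)\<close>, the state \<open>p\<close> just after an impulse belongs to a \<open>2 \<pi>\<close>-periodic
  solution exactly if \<open>\<Phi>\<^sub>2\<^sub>\<pi> p = R p\<close>, and
  \<open>R \<Phi>\<^sub>t R = \<Phi>\<^sub>-\<^sub>t\<close> makes every \<open>p = \<Phi>\<^sub>-\<^sub>\<pi> (x, 0)\<close> such a point.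

  Every real \<open>x\<close> can be taken, and \<open>x\<close> is recovered as the value of the solution midway between
  two impulse times, so there are infinitely many solutions. It remains to see that \<open>u\<close>
  exists on all of \<open>[- \<pi>, \<pi>]\<close>. As \<open>g'\<close> is bounded, the planar field is globally Lipschitz, and
  \<open>lipschitz_field_has_forward_solution\<close> gives a solution for all \<open>t \<ge> 0\<close>, which
  \<open>even_solution_exists\<close> reflects to negative times. The gluing is
  \<open>impulsive_solution_periodic_extension\<close>.\<close>

section \<open>Global solutions of Lipschitz differential equations\<close>

lemma norm_integral_le_exp:
  fixes f :: "real \<Rightarrow> 'a::banach"
  assumes "continuous_on {0..t} f" and "L > 0" and "C \<ge> 0" and "t \<ge> 0"
    and bound: "\<And>s. 0 \<le> s \<Longrightarrow> s \<le> t \<Longrightarrow> norm (f s) \<le> C * exp (L * s)"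
  shows "norm (integral {0..t} f) \<le> C / L * exp (L * t)"
proof -
  have int: "((\<lambda>s. C * exp (L * s)) has_integral C / L * exp (L * t) - C / L * exp (L * 0)) {0..t}"
    using \<open>t \<ge> 0\<close> \<open>L > 0\<close>
    by (intro fundamental_theorem_of_calculus)
       (auto intro!: derivative_eq_intros simp flip: has_real_derivative_iff_has_vector_derivative)
  have "norm (integral {0..t} f) \<le> integral {0..t} (\<lambda>s. C * exp (L * s))"
    using assms int
    by (intro integral_norm_bound_integral integrable_continuous_interval continuous_intros) auto
  also have "\<dots> = C / L * exp (L * t) - C / L"
    unfolding integral_unique[OF int] by simp
  finally show ?thesis
    using \<open>L > 0\<close> \<open>C \<ge> 0\<close> divide_nonneg_pos[of C L] by linarith
qed

text \<open>Picard iteration with an exponential weight. On continuous functions \<open>\<phi>\<close> that grow at most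
  like \<open>exp (L t)\<close>, with norm the supremum of \<open>exp (- L t) * norm (\<phi> t)\<close>, the Picard operator has
  Lipschitz constant \<open>K / L\<close>, however long the time interval. For \<open>L > K\<close> it is therefore a
  contraction, and its fixed point is a solution on the whole half-line. Below,
  \<open>\<psi>\<close> stands for \<open>exp (- L t) \<phi>(t)\<close>, which ranges over the bounded continuous functions.\<close>

lemma lipschitz_field_has_forward_solution:
  fixes F :: "'a::banach \<Rightarrow> 'a"
  assumes "K-lipschitz_on UNIV F"
  obtains \<phi> where "\<phi> 0 = x0"
    and "\<And>t. t \<ge> 0 \<Longrightarrow> (\<phi> has_vector_derivative F (\<phi> t)) (at t within {0..})"
proof -
  have K: "K \<ge> 0" using assms by (rule lipschitz_on_nonneg)
  have lip: "norm (F x - F y) \<le> K * norm (x - y)" for x y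
    using lipschitz_onD[OF assms, of x y] by (simp add: dist_norm)
  \<comment> \<open>Any \<open>L \<ge> 2 K\<close> gives contraction factor \<open>1/2\<close>; the summand 1 keeps \<open>L\<close> positive when \<open>K = 0\<close>.\<close>
  define L where "L = 2 * K + 1"
  have L: "L > 0" "K / L \<le> 1 / 2" using K by (auto simp: L_def field_simps)
  have contF[continuous_intros]: "continuous_on S (\<lambda>s. F (f s))"
    if "continuous_on S f" for S and f :: "real \<Rightarrow> 'a"
    using continuous_on_compose2[OF lipschitz_on_continuous_on[OF assms] that] by auto
  have cont\<psi>[continuous_intros]: "continuous_on S (apply_bcontfun \<psi>)" for \<psi> :: "real \<Rightarrow>\<^sub>C 'a" and S
    using apply_bcontfun[of \<psi>] by (auto simp: bcontfun_def intro: continuous_on_subset)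
  define I where "I \<psi> t = x0 + integral {0..t} (\<lambda>s. F (exp (L * s) *\<^sub>R apply_bcontfun \<psi> s))"
    for \<psi> t
  \<comment> \<open>Bounded continuous functions are defined on the whole line, so times are read through \<open>\<bar>t\<bar>\<close>.\<close>
  define T where "T \<psi> t = exp (- L * \<bar>t\<bar>) *\<^sub>R I \<psi> \<bar>t\<bar>" for \<psi> t
  have contI: "continuous_on {0..} (I \<psi>)" for \<psi>
  proof (subst continuous_on_eq_continuous_within, intro ballI)
    fix t :: real assume t: "t \<in> {0..}"
    have "continuous_on {0..t+1} (\<lambda>t. integral {0..t} (\<lambda>s. F (exp (L * s) *\<^sub>R apply_bcontfun \<psi> s)))"
      by (intro indefinite_integral_continuous_1 integrable_continuous_interval continuous_intros)
    hence "continuous_on {0..t+1} (I \<psi>)" unfolding I_def by (intro continuous_intros)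
    hence "continuous (at t within {0..t+1}) (I \<psi>)"
      using t by (auto simp: continuous_on_eq_continuous_within)
    moreover have "at t within {0..t+1} = at t within {0..}"
      using t by (intro at_within_nhd[of _ "{..<t+1}"]) auto
    ultimately show "continuous (at t within {0..}) (I \<psi>)" by (simp add: continuous_within)
  qed
  have T_bcontfun: "T \<psi> \<in> bcontfun" for \<psi>
  proof (rule bcontfun_normI)
    have "continuous_on UNIV (\<lambda>t. I \<psi> \<bar>t\<bar>)"
      by (rule continuous_on_compose2[OF contI]) (auto intro!: continuous_intros)
    thus "continuous_on UNIV (T \<psi>)" unfolding T_def by (intro continuous_intros)
    define C where "C = norm (F 0) + K * norm \<psi>"
    have C: "C \<ge> 0" using K by (simp add: C_def)
    fix t :: real
    have "norm (F (exp (L * s) *\<^sub>R apply_bcontfun \<psi> s)) \<le> C * exp (L * s)" if "0 \<le> s" for s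
    proof -
      have "norm (F (exp (L * s) *\<^sub>R apply_bcontfun \<psi> s))
          \<le> norm (F 0) + K * (exp (L * s) * norm (apply_bcontfun \<psi> s))"
        using lip[of "exp (L * s) *\<^sub>R apply_bcontfun \<psi> s" 0]
          norm_triangle_ineq2[of "F (exp (L * s) *\<^sub>R apply_bcontfun \<psi> s)" "F 0"] by simp
      also have "\<dots> \<le> norm (F 0) * exp (L * s) + K * (exp (L * s) * norm \<psi>)"
        using K L that norm_bounded[of \<psi> s]
        by (intro add_mono mult_left_mono) (auto intro: mult_right_le_one_le simp: mult_le_cancel_left1)
      finally show ?thesis by (simp add: C_def algebra_simps)
    qed
    hence "norm (integral {0..\<bar>t\<bar>} (\<lambda>s. F (exp (L * s) *\<^sub>R apply_bcontfun \<psi> s)))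
        \<le> C / L * exp (L * \<bar>t\<bar>)"
      by (intro norm_integral_le_exp C L continuous_intros) auto
    hence "norm (I \<psi> \<bar>t\<bar>) \<le> norm x0 * exp (L * \<bar>t\<bar>) + C / L * exp (L * \<bar>t\<bar>)"
      unfolding I_def using L
      by (intro norm_triangle_mono) (auto simp: mult_le_cancel_left1)
    hence "norm (I \<psi> \<bar>t\<bar>) / exp (L * \<bar>t\<bar>) \<le> norm x0 + C / L"
      by (simp only: pos_divide_le_eq exp_gt_zero distrib_right)
    thus "norm (T \<psi> t) \<le> norm x0 + C / L"
      by (simp add: T_def exp_minus divide_inverse mult.commute)
  qed
  have T_contraction: "dist (Bcontfun (T \<psi>)) (Bcontfun (T \<psi>')) \<le> 1 / 2 * dist \<psi> \<psi>'" for \<psi> \<psi>'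
  proof (rule dist_bound)
    fix t :: real
    define f where "f s = F (exp (L * s) *\<^sub>R apply_bcontfun \<psi> s)
      - F (exp (L * s) *\<^sub>R apply_bcontfun \<psi>' s)" for s
    have "norm (f s) \<le> K * dist \<psi> \<psi>' * exp (L * s)" for s
    proof -
      have "norm (f s) \<le> K * (exp (L * s) * dist (apply_bcontfun \<psi> s) (apply_bcontfun \<psi>' s))"
        unfolding f_def by (rule order_trans[OF lip]) (simp add: dist_norm flip: scaleR_diff_right)
      also have "\<dots> \<le> K * (exp (L * s) * dist \<psi> \<psi>')"
        using K dist_bounded[of \<psi> s \<psi>'] by (intro mult_left_mono) auto
      finally show ?thesis by (simp add: mult_ac)
    qed
    hence bound: "norm (integral {0..\<bar>t\<bar>} f) \<le> K * dist \<psi> \<psi>' / L * exp (L * \<bar>t\<bar>)"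
      unfolding f_def using K L by (intro norm_integral_le_exp continuous_intros) auto
    have "I \<psi> \<bar>t\<bar> - I \<psi>' \<bar>t\<bar> = integral {0..\<bar>t\<bar>} f"
      unfolding I_def f_def
      by (subst integral_diff) (auto intro!: integrable_continuous_interval continuous_intros)
    hence "dist (T \<psi> t) (T \<psi>' t) = norm (integral {0..\<bar>t\<bar>} f) / exp (L * \<bar>t\<bar>)"
      by (simp add: T_def dist_norm exp_minus divide_inverse mult.commute flip: scaleR_diff_right)
    also have "\<dots> \<le> K * dist \<psi> \<psi>' / L"
      by (simp only: pos_divide_le_eq exp_gt_zero bound)
    also have "\<dots> \<le> 1 / 2 * dist \<psi> \<psi>'"
      using mult_right_mono[OF L(2), of "dist \<psi> \<psi>'"] by simp
    finally show "dist (apply_bcontfun (Bcontfun (T \<psi>)) t) (apply_bcontfun (Bcontfun (T \<psi>')) t)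
        \<le> 1 / 2 * dist \<psi> \<psi>'"
      by (simp add: Bcontfun_inverse T_bcontfun)
  qed
  obtain \<psi> where \<psi>: "Bcontfun (T \<psi>) = \<psi>"
    using banach_fix_type[of "1/2" "\<lambda>\<psi>. Bcontfun (T \<psi>)"] T_contraction by auto
  hence fixed_point: "apply_bcontfun \<psi> t = T \<psi> t" for t
    by (metis Bcontfun_inverse T_bcontfun)
  have I_eq: "exp (L * t) *\<^sub>R apply_bcontfun \<psi> t = I \<psi> t" if "t \<ge> 0" for t
    using that by (simp add: fixed_point T_def flip: exp_add)
  show thesis
  proof
    show "I \<psi> 0 = x0" by (simp add: I_def)
    fix t :: real assume t: "t \<ge> 0"
    have "((\<lambda>t. x0 + integral {0..t} (\<lambda>s. F (exp (L * s) *\<^sub>R apply_bcontfun \<psi> s)))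
        has_vector_derivative 0 + F (exp (L * t) *\<^sub>R apply_bcontfun \<psi> t)) (at t within {0..t+1})"
      using t by (intro has_vector_derivative_add has_vector_derivative_const
        integral_has_vector_derivative continuous_intros) auto
    hence "(I \<psi> has_vector_derivative F (I \<psi> t)) (at t within {0..t+1})"
      by (simp add: I_eq[OF t] flip: I_def)
    moreover have "at t within {0..t+1} = at t within {0..}"
      using t by (intro at_within_nhd[of _ "{..<t+1}"]) auto
    ultimately show "(I \<psi> has_vector_derivative F (I \<psi> t)) (at t within {0..})" by simp
  qed
qed

section \<open>Even solutions of the oscillator equation\<close>

text \<open>Reflecting the derivative over \<open>{0..}\<close> gives the derivative over \<open>{..0}\<close>. At \<open>0\<close> the two
  one-sided derivatives agree because the parity of \<open>f'\<close> is assumed at \<open>0\<close> as well: for even \<open>f\<close> it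
  forces \<open>f' 0 = 0\<close>.\<close>

lemma has_derivative_by_parity:
  fixes f f' :: "real \<Rightarrow> real"
  assumes right: "\<And>t. t \<ge> 0 \<Longrightarrow> (f has_real_derivative f' t) (at t within {0..})"
    and parity: "\<And>t. f t = e * f (- t)" "\<And>t. f' t = - e * f' (- t)"
  shows "(f has_real_derivative f' t) (at t)"
proof -
  have left: "(f has_real_derivative f' t) (at t within {..0})" if "t \<le> 0" for t
  proof -
    have "((f \<circ> uminus) has_real_derivative f' (- t) * (- 1)) (at t within {..0})"
      using right[of "- t"] that
      by (intro DERIV_image_chain) (auto intro!: derivative_eq_intros)
    hence "((\<lambda>t. e * f (- t)) has_real_derivative - e * f' (- t)) (at t within {..0})"
      by (auto simp: o_def intro!: derivative_eq_intros)
    thus ?thesis by (simp only: parity(1)[symmetric] parity(2)[symmetric])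
  qed
  consider "t > 0" | "t < 0" | "t = 0" by linarith
  thus ?thesis
  proof cases
    case 1
    hence "at t within {0..} = at t" by (intro at_within_interior) simp
    thus ?thesis using right[of t] 1 by simp
  next
    case 2
    hence "at t within {..0} = at t" by (intro at_within_interior) simp
    thus ?thesis using left[of t] 2 by simp
  next
    case 3
    have "{0..} \<union> {..0} = (UNIV :: real set)" by auto
    thus ?thesis
      using right[of t] left[of t] 3 
      by (auto simp: has_field_derivative_iff intro: Lim_Un_univ)
  qed
qed

text \<open>The system is reversible: if \<open>(x(t), y(t))\<close> solves it, so does \<open>(x(- t), - y(- t))\<close>. A forward
  solution that starts on the axis \<open>y = 0\<close> therefore fits together with its own reflection.\<close>

lemma even_solution_exists:
  fixes g :: "real \<Rightarrow> real"
  assumes "K-lipschitz_on UNIV g"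
  obtains u v where "planar_solution g u v" and "u 0 = x0"
    and "\<And>t. u (- t) = u t" and "\<And>t. v (- t) = - v t"
proof -
  have "(1 + K)-lipschitz_on UNIV (\<lambda>(x, y :: real). (y, - g x))"
  proof (intro lipschitz_onI)
    show "0 \<le> 1 + K" using lipschitz_on_nonneg[OF assms] by simp
    fix p q :: "real \<times> real"
    obtain x y x' y' where pq: "p = (x, y)" "q = (x', y')" by (cases p, cases q)
    have "dist (y, - g x) (y', - g x') \<le> dist y y' + dist (g x) (g x')"
      using sqrt_sum_squares_le_sum[of "dist y y'" "dist (g x) (g x')"] by (simp add: dist_Pair_Pair dist_minus)
    also have "\<dots> \<le> dist y y' + K * dist x x'"
      using lipschitz_onD[OF assms, of x x'] by simp
    also have "\<dots> \<le> dist p q + K * dist p q"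
      using lipschitz_on_nonneg[OF assms] dist_fst_le[of p q] dist_snd_le[of p q]
      by (intro add_mono mult_left_mono) (auto simp: pq)
    finally show "dist (case p of (x, y) \<Rightarrow> (y, - g x)) (case q of (x, y) \<Rightarrow> (y, - g x))
        \<le> (1 + K) * dist p q"
      by (simp add: pq distrib_right)
  qed
  then obtain \<phi> where \<phi>: "\<phi> 0 = (x0, 0)"
      "\<And>t. t \<ge> 0 \<Longrightarrow> (\<phi> has_vector_derivative (case \<phi> t of (x, y) \<Rightarrow> (y, - g x))) (at t within {0..})"
    using lipschitz_field_has_forward_solution[of "1 + K" "\<lambda>(x, y). (y, - g x)" "(x0, 0)"] by blast
  define u where "u t = fst (\<phi> \<bar>t\<bar>)" for t
  define v where "v t = sgn t * snd (\<phi> \<bar>t\<bar>)" for t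
  have u_right: "(u has_real_derivative v t) (at t within {0..})" if t: "t \<ge> 0" for t
  proof -
    have "((\<lambda>t. fst (\<phi> t)) has_real_derivative snd (\<phi> t)) (at t within {0..})"
      using bounded_linear.has_vector_derivative[OF bounded_linear_fst \<phi>(2)[OF t]]
      by (simp add: has_real_derivative_iff_has_vector_derivative split_beta)
    moreover have "snd (\<phi> t) = v t" using t \<phi>(1) by (cases "t = 0") (auto simp: v_def)
    ultimately show ?thesis
      using has_field_derivative_transform_within[of "\<lambda>t. fst (\<phi> t)" "v t" t "{0..}" 1 u] t
      by (auto simp: u_def)
  qed
  have v_right: "(v has_real_derivative - g (u t)) (at t within {0..})" if t: "t \<ge> 0" for t
  proof -
    have "((\<lambda>t. snd (\<phi> t)) has_real_derivative - g (u t)) (at t within {0..})"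
      using bounded_linear.has_vector_derivative[OF bounded_linear_snd \<phi>(2)[OF t]] t
      by (simp add: has_real_derivative_iff_has_vector_derivative split_beta u_def)
    moreover have "snd (\<phi> s) = v s" if "s \<ge> 0" for s
      using that \<phi>(1) by (cases "s = 0") (auto simp: v_def)
    ultimately show ?thesis
      using has_field_derivative_transform_within[of "\<lambda>t. snd (\<phi> t)" "- g (u t)" t "{0..}" 1 v] t
      by auto
  qed
  show thesis
  proof
    show even: "u (- t) = u t" and odd: "v (- t) = - v t" for t by (auto simp: u_def v_def)
    show "u 0 = x0" by (simp add: u_def \<phi>)
    have "(u has_real_derivative v t) (at t)" for t
      by (rule has_derivative_by_parity[where e = 1, OF u_right]) (simp_all add: even odd)
    moreover have "(v has_real_derivative - g (u t)) (at t)" for t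
      by (rule has_derivative_by_parity[where e = "- 1", OF v_right]) (simp_all add: even odd)
    ultimately show "planar_solution g u v" by (simp add: planar_solution_def)
  qed
qed

section \<open>Periodic solutions of the impulsive equation\<close>

text \<open>On each interval \<open>[t1 + 2 \<pi> n, t1 + 2 \<pi> (n + 1))\<close> this is the restriction of \<open>u\<close> to
  \<open>[- \<pi>, \<pi>)\<close>, moved to the midpoint of the interval.\<close>

definition periodic_extension :: "real \<Rightarrow> (real \<Rightarrow> real) \<Rightarrow> real \<Rightarrow> real"
  where "periodic_extension t1 u t = u (t - t1 - 2 * pi * of_int \<lfloor>(t - t1) / (2 * pi)\<rfloor> - pi)"

lemma periodic_periodic_extension: "periodic (2 * pi) (periodic_extension t1 u)"
proof -
  have "(t + 2 * pi - t1) / (2 * pi) = (t - t1) / (2 * pi) + 1" for t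
    by (simp add: field_simps)
  thus ?thesis
    by (simp add: periodic_def periodic_extension_def algebra_simps)
qed

lemma periodic_extension_eq:
  assumes "t1 + 2 * pi * of_int n \<le> t" and "t < t1 + 2 * pi * of_int n + 2 * pi"
  shows "periodic_extension t1 u t = u (t - (t1 + 2 * pi * of_int n + pi))"
proof -
  have "\<lfloor>(t - t1) / (2 * pi)\<rfloor> = n"
    using assms by (intro floor_unique) (auto simp: field_simps)
  thus ?thesis by (simp add: periodic_extension_def algebra_simps)
qed

text \<open>Evenness of \<open>u\<close> is what makes the extension continuous at the impulse times, and oddness of
  \<open>v = u'\<close> is what turns the jump of the derivative there into a change of sign.\<close>

lemma impulsive_solution_periodic_extension:
  assumes sol: "planar_solution g u v"
    and even: "\<And>t. u (- t) = u t" and odd: "\<And>t. v (- t) = - v t"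
  shows "impulsive_solution g t1 (periodic_extension t1 u)"
proof -
  define z where "z = periodic_extension t1 u"
  \<comment> \<open>the midpoint of the \<open>n\<close>-th interval between impulse times\<close>
  define c where "c n = t1 + 2 * pi * of_int n + pi" for n :: int
  have u': "((\<lambda>t. u (t - d)) has_real_derivative v (t - d)) (at t)"
    and v': "((\<lambda>t. v (t - d)) has_real_derivative - g (u (t - d))) (at t)" for t d
    using sol DERIV_shift[of u "v (t - d)" t "- d"] DERIV_shift[of v "- g (u (t - d))" t "- d"]
    by (auto simp: planar_solution_def)
  have z_eq: "z t = u (t - c n)" if "t \<in> {c n - pi..<c n + pi}" for t n
    using that periodic_extension_eq[of t1 n t u] by (simp add: z_def c_def)
  have z': "(z has_real_derivative v (t - c n)) (at t)" if "t \<in> {c n - pi<..<c n + pi}" for t n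
    by (rule has_field_derivative_transform_within_open[OF u' _ that]) (auto simp: z_eq[where n = n])
  have deriv_z: "deriv z t = v (t - c n)" if "t \<in> {c n - pi<..<c n + pi}" for t n
    using z'[OF that] by (rule DERIV_imp_deriv)
  have z'': "(deriv z has_real_derivative - g (z t)) (at t)"
    if "t \<in> {c n - pi<..<c n + pi}" for t n
  proof -
    have "(deriv z has_real_derivative - g (u (t - c n))) (at t)"
      by (rule has_field_derivative_transform_within_open[OF v' _ that]) (auto simp: deriv_z[where n = n])
    thus ?thesis using that by (simp add: z_eq[where n = n])
  qed
  have smooth: "z differentiable at t \<and> deriv z differentiable at t \<and> deriv (deriv z) t + g (z t) = 0"
    if "t \<notin> impulse_times t1" for t
  proof -
    define n where "n = \<lfloor>(t - t1) / (2 * pi)\<rfloor>"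
    have "of_int n \<le> (t - t1) / (2 * pi)" "(t - t1) / (2 * pi) < of_int n + 1"
      by (auto simp: n_def)
    hence "t1 + 2 * pi * of_int n \<le> t" "t < t1 + 2 * pi * of_int n + 2 * pi"
      by (auto simp: field_simps)
    moreover have "t \<noteq> t1 + 2 * pi * of_int n"
      using that by (auto simp: impulse_times_def)
    ultimately have t: "t \<in> {c n - pi<..<c n + pi}" by (auto simp: c_def)
    show ?thesis
      using z'[OF t] z''[OF t] DERIV_imp_deriv[OF z''[OF t]]
      by (auto simp: real_differentiable_def)
  qed
  have jump: "isCont z t \<and> (\<exists>l r. one_sided_limits z t l r \<and> r - l = 0) \<and>
      (\<exists>l r. one_sided_limits (deriv z) t l r \<and> r - l = - 2 * l)"
    if "t \<in> impulse_times t1" for t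
  proof -
    obtain n where n: "t = t1 + 2 * pi * of_int n"
      using \<open>t \<in> impulse_times t1\<close> by (auto simp: impulse_times_def)
    have before: "t = c (n - 1) + pi" and after: "t = c n - pi"
      by (auto simp: n c_def algebra_simps)
    have near_left: "\<forall>\<^sub>F s in at_left t. s \<in> {c (n - 1) - pi<..<c (n - 1) + pi}"
      unfolding before[symmetric] by (rule eventually_at_left_real) (simp add: before)
    have near_right: "\<forall>\<^sub>F s in at_right t. s \<in> {c n - pi<..<c n + pi}"
      unfolding after[symmetric] by (rule eventually_at_right_real) (simp add: after)
    have limits: "((\<lambda>s. u (s - d)) \<longlongrightarrow> u (t - d)) (at t within S)"
      "((\<lambda>s. v (s - d)) \<longlongrightarrow> v (t - d)) (at t within S)" for d S
      by (rule tendsto_within_subset[OF DERIV_isCont[OF u', unfolded isCont_def] subset_UNIV],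
          rule tendsto_within_subset[OF DERIV_isCont[OF v', unfolded isCont_def] subset_UNIV])
    have "(z \<longlongrightarrow> u (t - c (n - 1))) (at_left t)"
      by (rule Lim_transform_eventually[OF limits(1)])
         (use near_left in eventually_elim, auto simp: z_eq[where n = "n - 1"])
    hence z_left: "(z \<longlongrightarrow> u pi) (at_left t)" by (simp add: before)
    have "(z \<longlongrightarrow> u (t - c n)) (at_right t)"
      by (rule Lim_transform_eventually[OF limits(1)])
         (use near_right in eventually_elim, auto simp: z_eq[where n = "n"])
    hence z_right: "(z \<longlongrightarrow> u pi) (at_right t)" by (simp add: after even)
    have "(deriv z \<longlongrightarrow> v (t - c (n - 1))) (at_left t)"
      by (rule Lim_transform_eventually[OF limits(2)])
         (use near_left in eventually_elim, auto simp: deriv_z[where n = "n - 1"])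
    hence z'_left: "(deriv z \<longlongrightarrow> v pi) (at_left t)" by (simp add: before)
    have "(deriv z \<longlongrightarrow> v (t - c n)) (at_right t)"
      by (rule Lim_transform_eventually[OF limits(2)])
         (use near_right in eventually_elim, auto simp: deriv_z[where n = "n"])
    hence z'_right: "(deriv z \<longlongrightarrow> - v pi) (at_right t)" by (simp add: after odd)
    have "z t = u pi" using z_eq[of t n] by (simp add: after even)
    hence "isCont z t"
      using z_left z_right by (simp add: isCont_def filterlim_split_at)
    thus ?thesis
      unfolding one_sided_limits_def
      using z_left z_right z'_left z'_right
      by (intro conjI exI[of _ "u pi"] exI[of _ "v pi"] exI[of _ "- v pi"]) auto
  qed
  show ?thesis
    using smooth jump unfolding impulsive_solution_def z_def by blast
qed

theorem theorem2p3:
  fixes g :: "real \<Rightarrow> real" and K A0 M0 \<alpha> c0 t1 :: real and m :: int and a b :: "nat \<Rightarrow> real"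
  assumes "g C1_differentiable_on UNIV"
    and "K > 0" and "\<And>x. \<bar>deriv g x\<bar> \<le> K"
    and "A0 > 0" and "M0 > 0" and "\<And>x. \<bar>x\<bar> \<ge> M0 \<Longrightarrow> inverse x * g x \<ge> A0"
    and "energy_threshold g c0"
    and "\<And>k. a k \<ge> c0" and "\<And>k. b k \<ge> c0"
    and "\<alpha> > 0" and "m > 0"
    and "filterlim a at_top sequentially" and "filterlim b at_top sequentially"
    and "\<And>k. orbit_period g (a k) < 2 * pi / of_int m - \<alpha>"
    and "\<And>k. orbit_period g (b k) > 2 * pi / of_int m + \<alpha>"
    and "0 \<le> t1" and "t1 < 2 * pi"
  shows "infinite {z :: real \<Rightarrow> real. impulsive_solution g t1 z \<and> periodic (2 * pi) z}"
proof -
  have g': "(g has_real_derivative deriv g x) (at x within UNIV)" for x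
    using assms(1) by (auto simp: C1_differentiable_on_eq DERIV_deriv_iff_real_differentiable)
  have "K-lipschitz_on UNIV g"
    using field_differentiable_bound[OF convex_UNIV g', of K] assms(2,3)
    by (intro lipschitz_onI) (auto simp: dist_norm)
  note even_solution = even_solution_exists[OF this]
  have "\<exists>z. impulsive_solution g t1 z \<and> periodic (2 * pi) z \<and> x = z (t1 + pi)" for x
  proof -
    obtain u v where "planar_solution g u v" "u 0 = x"
        "\<And>t. u (- t) = u t" "\<And>t. v (- t) = - v t"
      using even_solution by blast
    moreover have "periodic_extension t1 u (t1 + pi) = u 0"
      using periodic_extension_eq[of t1 0 "t1 + pi" u] by simp
    ultimately show ?thesis
      using impulsive_solution_periodic_extension[of g u v t1] periodic_periodic_extension[of t1 u]
      by metis
  qed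
  \<comment> \<open>Evaluation midway between two impulse times maps the set of solutions onto the real line.\<close>
  hence "UNIV \<subseteq> (\<lambda>z. z (t1 + pi)) ` {z. impulsive_solution g t1 z \<and> periodic (2 * pi) z}"
    by (auto simp: image_iff)
  thus ?thesis
    using infinite_UNIV_char_0[where 'a = real] finite_imageI finite_subset by blast
qed

end
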